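(* The operators $\mathcal{D}_v^k$ ($v\in V$) on $C^\infty(V_{reg})$ satisfy: (i) The cross relation $$s_a\mathcal{D}_v^k=\mathcal{D}_{s_{Da}v}^ks_a+k_aDa(v),\qquad v\in V,\ a\in I.$$ (ii) The Dunkl operators $\mathcal{D}_v^k$ ($v\in V$) pair-wise commute.
   Context: Root systems. Let $V$ be a Euclidean space of dimension $n$ and $V^*$ the dual Euclidean space, with norm $\|\cdot\|$ and inner product $\langle\cdot,\cdot\rangle$ on $V^*$. Let $\Sigma_0\subset V^*$ be a finite, irreducible, reduced crystallographic root system. The co-root $\alpha^\vee\in V$ of $\alpha\in\Sigma_0$ is determined by $\xi(\alpha^\vee)=2\langle\xi,\alpha\rangle/\|\alpha\|^2$ for all $\xi\in V^*$. Fix a basis $I_0=\{a_1,\ldots,a_n\}$ of $\Sigma_0$, with highest root $\varphi$. For $\alpha\in\Sigma_0$, $s_\alpha v=v-\alpha(v)\alpha^\vee$ on $V$. Affine root system. Affine linear functionals on $V$ are written as elements of $V^*\oplus\mathbb{R}$, and $D$ denotes the projection onto $V^*$ (the gradient). The affine root system is $\Sigma=\Sigma_0+\mathbb{Z}$, with basis $I=\{a_0=-\varphi+1,a_1,\ldots,a_n\}$ and corresponding positive roots $\Sigma^+$. For $a\in\Sigma$ write $Da^\vee=(Da)^\vee$, $V_a=a^{-1}(0)$, and $s_a(v)=v-a(v)Da^\vee$. The affine Weyl group $W$ is generated by all $s_a$ ($a\in\Sigma$). $W$ acts on functions on $V$ (including affine functionals) and on functions on $V_{reg}=V\setminus\bigcup_{a\in\Sigma^+}V_a$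 by $(wf)(v)=f(w^{-1}v)$. Multiplicity function. $k:\Sigma\to\mathbb{R}_{>0}$ is a fixed $W$-invariant function with $k(a)=k(Da)$ for all $a\in\Sigma$; write $k_a=k(a)$. Dunkl-type operators. For $a\in\Sigma$ let $\chi_a$ be the (locally constant) function on $V_{reg}$ with $\chi_a(v)=1$ if $a(v)<0$ and $\chi_a(v)=0$ if $a(v)>0$. On a given connected component of $V_{reg}$, $\chi_a$ is nonzero for only finitely many $a\in\Sigma^+$. For $v\in V$ define the linear operator on the space $C^\infty(V_{reg})$ of complex-valued smooth functions on $V_{reg}$ $$\mathcal{D}_v^k=\partial_v+\sum_{a\in\Sigma^+}k_aDa(v)\chi_a(\cdot)s_a,$$ where $\partial_v$ is the derivative in direction $v$ and $Da(v)$ is the value of $Da\in V^*$ at $v$. *)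

theory Defs
  imports "HOL-Analysis.Analysis" "HOL-Algebra.Bij" "HOL-Algebra.Generated_Groups"
begin

text \<open>The ambient space $V$ is the type \<open>'a::euclidean_space\<close>, its dual $V^*$ is the type
  \<open>'a \<Rightarrow>\<^sub>L real\<close>, and the affine linear functionals $V^* \oplus \mathbb{R}$ form the
  type \<open>('a \<Rightarrow>\<^sub>L real) \<times> real\<close>; the gradient map is \<^const>\<open>fst\<close>.\<close>

text \<open>The inner product of the dual Euclidean space, for which the dual basis of an orthonormal
  basis is orthonormal. The library provides only the (operator) norm on this type.\<close>

definition dual_inner :: "('a::euclidean_space \<Rightarrow>\<^sub>L real) \<Rightarrow> ('a \<Rightarrow>\<^sub>L real) \<Rightarrow> real" where
  "dual_inner \<xi> \<eta> = (\<Sum>b\<in>Basis. blinfun_apply \<xi> b * blinfun_apply \<eta> b)"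

definition coroot :: "('a::euclidean_space \<Rightarrow>\<^sub>L real) \<Rightarrow> 'a" where
  "coroot \<alpha> = (THE x. \<forall>\<xi>. blinfun_apply \<xi> x = 2 * dual_inner \<xi> \<alpha> / dual_inner \<alpha> \<alpha>)"

lemma coroot_eq:
  "coroot \<alpha> = (\<Sum>b\<in>Basis. (2 * blinfun_apply \<alpha> b / dual_inner \<alpha> \<alpha>) *\<^sub>R b)"
  unfolding coroot_def
proof (rule the_equality)
  show "\<forall>\<xi>. blinfun_apply \<xi> (\<Sum>b\<in>Basis. (2 * blinfun_apply \<alpha> b / dual_inner \<alpha> \<alpha>) *\<^sub>R b)
      = 2 * dual_inner \<xi> \<alpha> / dual_inner \<alpha> \<alpha>"
    by (auto simp: blinfun.sum_right blinfun.scaleR_right dual_inner_def[of _ \<alpha>]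
        sum_distrib_left sum_divide_distrib mult_ac intro!: sum.cong)
next
  fix x assume x: "\<forall>\<xi>. blinfun_apply \<xi> x = 2 * dual_inner \<xi> \<alpha> / dual_inner \<alpha> \<alpha>"
  show "x = (\<Sum>b\<in>Basis. (2 * blinfun_apply \<alpha> b / dual_inner \<alpha> \<alpha>) *\<^sub>R b)"
  proof (rule euclidean_eqI)
    fix c :: 'a assume c: "c \<in> Basis"
    have "dual_inner (blinfun_inner_left c) \<alpha> = blinfun_apply \<alpha> c"
    proof -
      have "dual_inner (blinfun_inner_left c) \<alpha>
          = (\<Sum>b\<in>Basis. if b = c then blinfun_apply \<alpha> b else 0)"
        unfolding dual_inner_def using c by (intro sum.cong) (auto simp: inner_Basis)
      then show ?thesis using c by simp
    qed
    with x[rule_format, of "blinfun_inner_left c"]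
    have "x \<bullet> c = 2 * blinfun_apply \<alpha> c / dual_inner \<alpha> \<alpha>"
      by (simp add: inner_commute)
    then show "x \<bullet> c = (\<Sum>b\<in>Basis. (2 * blinfun_apply \<alpha> b / dual_inner \<alpha> \<alpha>) *\<^sub>R b) \<bullet> c"
      using c by simp
  qed
qed

lemma blinfun_apply_coroot:
  "blinfun_apply \<xi> (coroot \<alpha>) = 2 * dual_inner \<xi> \<alpha> / dual_inner \<alpha> \<alpha>"
  unfolding coroot_eq
  by (auto simp: blinfun.sum_right blinfun.scaleR_right dual_inner_def[of _ \<alpha>]
      sum_distrib_left sum_divide_distrib mult_ac intro!: sum.cong)

definition root_system :: "('a::euclidean_space \<Rightarrow>\<^sub>L real) set \<Rightarrow> bool" where
  "root_system R \<longleftrightarrow> finite R \<and> 0 \<notin> R \<and> span R = UNIV \<and>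
     (\<forall>\<alpha>\<in>R. \<forall>\<beta>\<in>R. \<beta> - blinfun_apply \<beta> (coroot \<alpha>) *\<^sub>R \<alpha> \<in> R)"

definition crystallographic :: "('a::euclidean_space \<Rightarrow>\<^sub>L real) set \<Rightarrow> bool" where
  "crystallographic R \<longleftrightarrow> (\<forall>\<alpha>\<in>R. \<forall>\<beta>\<in>R. blinfun_apply \<beta> (coroot \<alpha>) \<in> \<int>)"

definition reduced_roots :: "('a::euclidean_space \<Rightarrow>\<^sub>L real) set \<Rightarrow> bool" where
  "reduced_roots R \<longleftrightarrow> (\<forall>\<alpha>\<in>R. \<forall>c::real. c *\<^sub>R \<alpha> \<in> R \<longrightarrow> c = 1 \<or> c = - 1)"

definition irreducible_roots :: "('a::euclidean_space \<Rightarrow>\<^sub>L real) set \<Rightarrow> bool" where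
  "irreducible_roots R \<longleftrightarrow> R \<noteq> {} \<and>
     \<not> (\<exists>R1 R2. R1 \<noteq> {} \<and> R2 \<noteq> {} \<and> R1 \<inter> R2 = {} \<and> R = R1 \<union> R2 \<and>
          (\<forall>\<alpha>\<in>R1. \<forall>\<beta>\<in>R2. dual_inner \<alpha> \<beta> = 0))"

definition nonneg_comb :: "'b::real_vector set \<Rightarrow> 'b \<Rightarrow> bool" where
  "nonneg_comb B x \<longleftrightarrow> (\<exists>c::'b \<Rightarrow> nat. x = (\<Sum>b\<in>B. real (c b) *\<^sub>R b))"

definition root_basis ::
    "('a::euclidean_space \<Rightarrow>\<^sub>L real) set \<Rightarrow> ('a \<Rightarrow>\<^sub>L real) set \<Rightarrow> bool" where
  "root_basis R I0 \<longleftrightarrow> I0 \<subseteq> R \<and> independent I0 \<and>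
     (\<forall>\<alpha>\<in>R. nonneg_comb I0 \<alpha> \<or> nonneg_comb I0 (- \<alpha>))"

definition highest_root ::
    "('a::euclidean_space \<Rightarrow>\<^sub>L real) set \<Rightarrow> ('a \<Rightarrow>\<^sub>L real) set \<Rightarrow> ('a \<Rightarrow>\<^sub>L real) \<Rightarrow> bool" where
  "highest_root R I0 \<phi> \<longleftrightarrow> \<phi> \<in> R \<and> (\<forall>\<alpha>\<in>R. nonneg_comb I0 (\<phi> - \<alpha>))"

definition lin_refl :: "('a::euclidean_space \<Rightarrow>\<^sub>L real) \<Rightarrow> 'a \<Rightarrow> 'a" where
  "lin_refl \<alpha> v = v - blinfun_apply \<alpha> v *\<^sub>R coroot \<alpha>"

definition aff :: "('a::euclidean_space \<Rightarrow>\<^sub>L real) \<times> real \<Rightarrow> 'a \<Rightarrow> real" where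
  "aff a v = blinfun_apply (fst a) v + snd a"

definition aff_refl :: "('a::euclidean_space \<Rightarrow>\<^sub>L real) \<times> real \<Rightarrow> 'a \<Rightarrow> 'a" where
  "aff_refl a v = v - aff a v *\<^sub>R coroot (fst a)"

definition affine_roots ::
    "('a::euclidean_space \<Rightarrow>\<^sub>L real) set \<Rightarrow> (('a \<Rightarrow>\<^sub>L real) \<times> real) set" where
  "affine_roots R = R \<times> \<int>"

definition affine_basis ::
    "('a::euclidean_space \<Rightarrow>\<^sub>L real) set \<Rightarrow> ('a \<Rightarrow>\<^sub>L real) \<Rightarrow> (('a \<Rightarrow>\<^sub>L real) \<times> real) set" where
  "affine_basis I0 \<phi> = insert (- \<phi>, 1) (I0 \<times> {0})"

definition affine_pos_roots ::
    "('a::euclidean_space \<Rightarrow>\<^sub>L real) set \<Rightarrow> ('a \<Rightarrow>\<^sub>L real) set \<Rightarrow> ('a \<Rightarrow>\<^sub>L real)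
      \<Rightarrow> (('a \<Rightarrow>\<^sub>L real) \<times> real) set" where
  "affine_pos_roots R I0 \<phi> = {a \<in> affine_roots R. nonneg_comb (affine_basis I0 \<phi>) a}"

definition affine_weyl_group :: "('a::euclidean_space \<Rightarrow>\<^sub>L real) set \<Rightarrow> ('a \<Rightarrow> 'a) set" where
  "affine_weyl_group R = generate (BijGroup UNIV) (aff_refl ` affine_roots R)"

text \<open>\<open>inv_into UNIV w\<close> is the inverse map of \<open>w\<close> (the notation \<open>inv\<close> also
  denotes inverses in a group record here).\<close>

definition act :: "('a \<Rightarrow> 'a) \<Rightarrow> ('a \<Rightarrow> 'b) \<Rightarrow> 'a \<Rightarrow> 'b" where
  "act w f = (\<lambda>v. f (inv_into UNIV w v))"

definition multiplicity_function ::
    "('a::euclidean_space \<Rightarrow>\<^sub>L real) set \<Rightarrow> (('a \<Rightarrow>\<^sub>L real) \<times> real \<Rightarrow> real) \<Rightarrow> bool" where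
  "multiplicity_function R k \<longleftrightarrow>
     (\<forall>a\<in>affine_roots R. k a > 0) \<and>
     (\<forall>w\<in>affine_weyl_group R. \<forall>a\<in>affine_roots R. \<forall>b\<in>affine_roots R.
        aff b = act w (aff a) \<longrightarrow> k b = k a) \<and>
     (\<forall>a\<in>affine_roots R. k a = k (fst a, 0))"

definition V_reg ::
    "('a::euclidean_space \<Rightarrow>\<^sub>L real) set \<Rightarrow> ('a \<Rightarrow>\<^sub>L real) set \<Rightarrow> ('a \<Rightarrow>\<^sub>L real) \<Rightarrow> 'a set" where
  "V_reg R I0 \<phi> = UNIV - (\<Union>a\<in>affine_pos_roots R I0 \<phi>. {v. aff a v = 0})"

definition dir_deriv :: "'a::real_normed_vector \<Rightarrow> ('a \<Rightarrow> complex) \<Rightarrow> 'a \<Rightarrow> complex" where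
  "dir_deriv v f x = frechet_derivative f (at x) v"

primrec times_cont_diff_on ::
    "nat \<Rightarrow> 'a::real_normed_vector set \<Rightarrow> ('a \<Rightarrow> complex) \<Rightarrow> bool" where
  "times_cont_diff_on 0 S f \<longleftrightarrow> continuous_on S f"
| "times_cont_diff_on (Suc n) S f \<longleftrightarrow>
     (\<forall>x\<in>S. f differentiable (at x)) \<and> (\<forall>v. times_cont_diff_on n S (dir_deriv v f))"

text \<open>Elements of $C^\infty(S)$, for open \<open>S\<close>, are represented by total functions whose
  values off \<open>S\<close> are arbitrary. Two of them are equal in $C^\infty(S)$ iff they agree on
  \<open>S\<close>, so identities between operators below are asserted pointwise on \<open>S\<close>.\<close>

definition C_infinity :: "'a::real_normed_vector set \<Rightarrow> ('a \<Rightarrow> complex) set" where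
  "C_infinity S = {f. \<forall>n. times_cont_diff_on n S f}"

definition chi :: "('a::euclidean_space \<Rightarrow>\<^sub>L real) \<times> real \<Rightarrow> 'a \<Rightarrow> real" where
  "chi a v = (if aff a v < 0 then 1 else 0)"

text \<open>The sum over the (infinite) set of positive affine roots is taken over the roots whose term
  has \<^prop>\<open>chi a x \<noteq> 0\<close>; \<open>finite_chi_support\<close> shows that these are finitely many.\<close>

definition dunkl ::
    "('a::euclidean_space \<Rightarrow>\<^sub>L real) set \<Rightarrow> ('a \<Rightarrow>\<^sub>L real) set \<Rightarrow> ('a \<Rightarrow>\<^sub>L real)
      \<Rightarrow> (('a \<Rightarrow>\<^sub>L real) \<times> real \<Rightarrow> real) \<Rightarrow> 'a \<Rightarrow> ('a \<Rightarrow> complex) \<Rightarrow> 'a \<Rightarrow> complex" where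
  "dunkl R I0 \<phi> k v f x = dir_deriv v f x +
     (\<Sum>a\<in>{a \<in> affine_pos_roots R I0 \<phi>. chi a x \<noteq> 0}.
        complex_of_real (k a * blinfun_apply (fst a) v * chi a x) * act (aff_refl a) f x)"

lemma affine_pos_roots_snd_nonneg:
  assumes "a \<in> affine_pos_roots R I0 \<phi>"
  shows "snd a \<ge> 0"
proof -
  obtain c :: "_ \<Rightarrow> nat" where "a = (\<Sum>b\<in>affine_basis I0 \<phi>. real (c b) *\<^sub>R b)"
    using assms by (auto simp: affine_pos_roots_def nonneg_comb_def)
  then have "snd a = (\<Sum>b\<in>affine_basis I0 \<phi>. real (c b) * snd b)"
    by (simp add: snd_sum)
  also have "\<dots> \<ge> 0"
    by (rule sum_nonneg) (auto simp: affine_basis_def)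
  finally show ?thesis .
qed

lemma finite_chi_support:
  assumes "finite R"
  shows "finite {a \<in> affine_pos_roots R I0 \<phi>. chi a x \<noteq> 0}"
proof (rule finite_subset)
  let ?J = "\<lambda>\<alpha>. real_of_int ` {0..\<lceil>- blinfun_apply \<alpha> x\<rceil>}"
  show "finite (Sigma R ?J)"
    using assms by auto
  show "{a \<in> affine_pos_roots R I0 \<phi>. chi a x \<noteq> 0} \<subseteq> Sigma R ?J"
  proof
    fix a assume a: "a \<in> {a \<in> affine_pos_roots R I0 \<phi>. chi a x \<noteq> 0}"
    then obtain \<alpha> m where am: "a = (\<alpha>, real_of_int m)" "\<alpha> \<in> R"
      by (auto simp: affine_pos_roots_def affine_roots_def elim!: Ints_cases)
    have "m \<ge> 0"
      using affine_pos_roots_snd_nonneg[of a R I0 \<phi>] a am by simp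
    moreover have "real_of_int m < - blinfun_apply \<alpha> x"
      using a am by (auto simp: chi_def aff_def split: if_splits)
    then have "m \<le> \<lceil>- blinfun_apply \<alpha> x\<rceil>"
      by linarith
    ultimately show "a \<in> Sigma R ?J"
      using am by auto
  qed
qed

end

theory Submission
  imports Defs
begin

text \<open>The simple reflection of \<open>a \<in> I\<close> permutes the positive affine roots other than \<open>a\<close>, which
  gives the cross relation. On the fundamental alcove all \<open>\<chi>\<^sub>a\<close> with \<open>a\<close> positive vanish, so the
  Dunkl operators are plain directional derivatives there and commute by symmetry of second
  derivatives. The cross relation carries the vanishing of all commutators at \<open>x\<close> to the point
  \<open>s\<^sub>a x\<close>; since every regular point with a negative positive root has a negative simple root,
  and reflecting in it lowers the number of positive roots that are negative at the point,
  induction on that number reaches every regular point.\<close>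

section \<open>Symmetry of second directional derivatives\<close>

lemma dir_deriv_eq:
  assumes "(f has_derivative f') (at x)"
  shows "dir_deriv v f x = f' v"
  using frechet_derivative_at[OF assms] by (simp add: dir_deriv_def)

lemma has_derivative_dir_deriv:
  "f differentiable (at x) \<Longrightarrow> (f has_derivative (\<lambda>v. dir_deriv v f x)) (at x)"
  by (simp add: dir_deriv_def frechet_derivative_works)

text \<open>Functions that agree near x have the same derivatives at x, if any, so the choice made
  in \<open>frechet_derivative\<close> returns the same map for both.\<close>

lemma dir_deriv_cong_open:
  assumes "open S" "x \<in> S" "\<And>y. y \<in> S \<Longrightarrow> f y = g y"
  shows "dir_deriv v f x = dir_deriv v g x"
proof -
  have "(f has_derivative f') (at x) \<longleftrightarrow> (g has_derivative f') (at x)" for f'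
    using assms by (metis has_derivative_transform_within_open)
  then show ?thesis by (simp add: dir_deriv_def frechet_derivative_def)
qed

text \<open>This is the mean value inequality on [0,h] for the auxiliary \<open>G\<close>, whose
  derivative is a difference of two first-order remainders of the u-derivative of f. The
  second-order input is the expansion \<open>bnd\<close> of that derivative at x.\<close>

lemma second_difference_bound:
  fixes f :: "'a::real_normed_vector \<Rightarrow> complex"
  assumes f: "\<And>y. y \<in> ball x \<delta> \<Longrightarrow> f differentiable (at y)"
    and L: "bounded_linear L"
    and bnd: "\<And>y. y \<in> ball x \<delta> \<Longrightarrow>
      norm (dir_deriv u f y - dir_deriv u f x - L (y - x)) \<le> e * norm (y - x)"
    and h: "0 < h" "h * (norm u + norm v) < \<delta>" and e: "0 \<le> e"
  shows "norm (f (x + h *\<^sub>R u + h *\<^sub>R v) - f (x + h *\<^sub>R u) - f (x + h *\<^sub>R v) + f x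
      - (h * h) *\<^sub>R L v) \<le> e * (2 * norm u + norm v) * (h * h)"
proof -
  interpret L: bounded_linear L by (rule L)
  define G where "G s = f (x + s *\<^sub>R u + h *\<^sub>R v) - f (x + s *\<^sub>R u) - (s * h) *\<^sub>R L v" for s
  define G' where "G' s = dir_deriv u f (x + s *\<^sub>R u + h *\<^sub>R v) - dir_deriv u f (x + s *\<^sub>R u)
    - h *\<^sub>R L v" for s
  have nrm: "norm (s *\<^sub>R u) \<le> h * norm u" "norm (s *\<^sub>R u + h *\<^sub>R v) \<le> h * (norm u + norm v)"
    if "s \<in> {0..h}" for s
  proof -
    show *: "norm (s *\<^sub>R u) \<le> h * norm u" using that by (simp add: mult_right_mono)
    have "norm (s *\<^sub>R u + h *\<^sub>R v) \<le> norm (s *\<^sub>R u) + norm (h *\<^sub>R v)" by (rule norm_triangle_ineq)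
    then show "norm (s *\<^sub>R u + h *\<^sub>R v) \<le> h * (norm u + norm v)"
      using * h by (simp add: distrib_left)
  qed
  have inb: "x + s *\<^sub>R u \<in> ball x \<delta>" "x + s *\<^sub>R u + h *\<^sub>R v \<in> ball x \<delta>" if "s \<in> {0..h}" for s
  proof -
    have "h * norm u \<le> h * (norm u + norm v)" using h by simp
    then have "norm (s *\<^sub>R u) < \<delta>" "norm (s *\<^sub>R u + h *\<^sub>R v) < \<delta>"
      using nrm[OF that] h by linarith+
    then show "x + s *\<^sub>R u \<in> ball x \<delta>" "x + s *\<^sub>R u + h *\<^sub>R v \<in> ball x \<delta>"
      by (simp_all only: mem_ball dist_norm norm_minus_commute[of x] add_diff_cancel_left' add.assoc)
  qed
  have der: "(G has_derivative (\<lambda>t. t *\<^sub>R G' s)) (at s within {0..h})" if s: "s \<in> {0..h}" for s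
  proof -
    have comp: "((\<lambda>s. f (p + s *\<^sub>R u)) has_derivative
        (\<lambda>t. dir_deriv (t *\<^sub>R u) f (p + s *\<^sub>R u))) (at s)" if "p + s *\<^sub>R u \<in> ball x \<delta>" for p
    proof -
      have "((\<lambda>s. p + s *\<^sub>R u) has_derivative (\<lambda>t. t *\<^sub>R u)) (at s)"
        by (auto intro!: derivative_eq_intros)
      from has_derivative_compose[OF this, of f, OF has_derivative_dir_deriv[OF f[OF that]]]
      show ?thesis .
    qed
    have d1: "((\<lambda>s. f (x + s *\<^sub>R u + h *\<^sub>R v)) has_derivative
        (\<lambda>t. dir_deriv (t *\<^sub>R u) f (x + s *\<^sub>R u + h *\<^sub>R v))) (at s)"
      using comp[of "x + h *\<^sub>R v"] inb(2)[OF s] by (simp add: add_ac)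
    note d2 = comp[OF inb(1)[OF s]]
    have lin: "dir_deriv (t *\<^sub>R u) f y = t *\<^sub>R dir_deriv u f y" if "y \<in> ball x \<delta>" for t y
      by (rule linear_scale[OF has_derivative_linear[OF has_derivative_dir_deriv[OF f[OF that]]]])
    have "(G has_derivative (\<lambda>t. dir_deriv (t *\<^sub>R u) f (x + s *\<^sub>R u + h *\<^sub>R v)
        - dir_deriv (t *\<^sub>R u) f (x + s *\<^sub>R u) - (t * h) *\<^sub>R L v)) (at s)"
      unfolding G_def by (intro has_derivative_diff d1 d2) (auto intro!: derivative_eq_intros)
    then have "(G has_derivative (\<lambda>t. t *\<^sub>R G' s)) (at s)"
      by (simp only: lin inb[OF s] G'_def scaleR_right_diff_distrib scaleR_scaleR)
    then show ?thesis by (rule has_derivative_at_withinI)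
  qed
  have "norm (G h - G 0) \<le> (e * (h * (2 * norm u + norm v))) * norm (h - 0)"
  proof (rule differentiable_bound[OF convex_real_interval(5) der])
    fix s assume s: "s \<in> {0..h}"
    let ?p = "x + s *\<^sub>R u + h *\<^sub>R v" and ?q = "x + s *\<^sub>R u"
    \<comment> \<open>The values at x cancel, and by linearity the two values of L differ by h L
      v.\<close>
    have "G' s = (dir_deriv u f ?p - dir_deriv u f x - L (?p - x))
        - (dir_deriv u f ?q - dir_deriv u f x - L (?q - x))"
      by (simp add: G'_def L.add L.scaleR algebra_simps L.diff)
    then have "norm (G' s) \<le> norm (dir_deriv u f ?p - dir_deriv u f x - L (?p - x))
        + norm (dir_deriv u f ?q - dir_deriv u f x - L (?q - x))"
      by (metis norm_triangle_ineq4)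
    also have "\<dots> \<le> e * norm (s *\<^sub>R u + h *\<^sub>R v) + e * norm (s *\<^sub>R u)"
      using bnd[OF inb(1)[OF s]] bnd[OF inb(2)[OF s]] by (simp add: add.assoc)
    also have "\<dots> \<le> e * (h * (norm u + norm v)) + e * (h * norm u)"
      using nrm[OF s] e by (intro add_mono mult_left_mono)
    finally have "norm (G' s) \<le> e * (h * (2 * norm u + norm v))" by (simp add: algebra_simps)
    then show "onorm (\<lambda>t. t *\<^sub>R G' s) \<le> e * (h * (2 * norm u + norm v))"
      by (simp add: onorm_scaleR_left[OF bounded_linear_ident] onorm_id)
  qed (use h in auto)
  then show ?thesis
    using h by (simp add: G_def algebra_simps)
qed

text \<open>The second difference of f is symmetric in u and v, and after division by h^2 it
  approximates both mixed derivatives. Hence they differ by at most e C for every e > 0.\<close>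

lemma dir_deriv_commute:
  fixes f :: "'a::real_normed_vector \<Rightarrow> complex"
  assumes S: "open S" "x \<in> S" and f: "\<And>y. y \<in> S \<Longrightarrow> f differentiable (at y)"
    and f2: "\<And>v. dir_deriv v f differentiable (at x)"
  shows "dir_deriv u (dir_deriv v f) x = dir_deriv v (dir_deriv u f) x"
proof -
  define D where "D w y = dir_deriv y (dir_deriv w f) x" for w y
  have D: "(dir_deriv w f has_derivative D w) (at x)" for w
    unfolding D_def by (rule has_derivative_dir_deriv[OF f2])
  define C where "C = (2 * norm u + norm v) + (2 * norm v + norm u)"
  obtain r where r: "r > 0" "ball x r \<subseteq> S" using S openE by blast
  have "norm (D u v - D v u) \<le> e * C" if e: "e > 0" for e
  proof -
    have ex: "\<exists>d>0. \<forall>y. norm (y - x) < d \<longrightarrow>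
        norm (dir_deriv w f y - dir_deriv w f x - D w (y - x)) \<le> e * norm (y - x)" for w
      using D[of w, unfolded has_derivative_at_alt] e by blast
    obtain d1 where d1: "d1 > 0" "\<And>y. norm (y - x) < d1 \<Longrightarrow>
        norm (dir_deriv u f y - dir_deriv u f x - D u (y - x)) \<le> e * norm (y - x)"
      using ex[of u] by blast
    obtain d2 where d2: "d2 > 0" "\<And>y. norm (y - x) < d2 \<Longrightarrow>
        norm (dir_deriv v f y - dir_deriv v f x - D v (y - x)) \<le> e * norm (y - x)"
      using ex[of v] by blast
    define d where "d = min r (min d1 d2)"
    have d: "d > 0" using r d1 d2 by (simp add: d_def)
    \<comment> \<open>The summand 1 keeps the denominator positive for u = v = 0 and makes the bound
      h (|u| + |v|) < d strict.\<close>
    define h where "h = d / (norm u + norm v + 1)"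
    have pos: "norm u + norm v + 1 > 0" by (simp add: add_nonneg_pos)
    have h: "h > 0" "h * (norm u + norm v) < d"
      using d pos by (simp_all add: h_def field_simps)
    have f': "f differentiable (at y)" if "y \<in> ball x d" for y
      using f r that by (auto simp: d_def)
    have bl: "bounded_linear (D w)" for w
      using D by (rule has_derivative_bounded_linear)
    let ?A = "f (x + h *\<^sub>R u + h *\<^sub>R v) - f (x + h *\<^sub>R u) - f (x + h *\<^sub>R v) + f x"
    let ?B = "f (x + h *\<^sub>R v + h *\<^sub>R u) - f (x + h *\<^sub>R v) - f (x + h *\<^sub>R u) + f x"
    have 1: "norm (?A - (h * h) *\<^sub>R D u v) \<le> e * (2 * norm u + norm v) * (h * h)"
      by (rule second_difference_bound[where \<delta> = d])
        (use f' bl d1(2) h e in \<open>auto simp: d_def dist_norm norm_minus_commute[of x]\<close>)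
    have 2: "norm (?B - (h * h) *\<^sub>R D v u) \<le> e * (2 * norm v + norm u) * (h * h)"
      by (rule second_difference_bound[where \<delta> = d])
        (use f' bl d2(2) h e in \<open>auto simp: d_def dist_norm norm_minus_commute[of x] add.commute\<close>)
    have "?A = ?B" by (simp add: algebra_simps)
    then have "(h * h) *\<^sub>R (D u v - D v u) = (?B - (h * h) *\<^sub>R D v u) - (?A - (h * h) *\<^sub>R D u v)"
      by (simp add: algebra_simps)
    then have "norm ((h * h) *\<^sub>R (D u v - D v u)) \<le>
        e * (2 * norm v + norm u) * (h * h) + e * (2 * norm u + norm v) * (h * h)"
      using norm_triangle_ineq4 1 2 by (smt (verit))
    then have "(h * h) * norm (D u v - D v u) \<le> (h * h) * (e * C)"
      by (simp add: C_def distrib_left mult_ac)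
    then show ?thesis using h by simp
  qed
  moreover have C: "C \<ge> 0" by (simp add: C_def)
  ultimately have "norm (D u v - D v u) \<le> 0 + e" if "e > 0" for e
  proof -
    have "norm (D u v - D v u) \<le> e / (C + 1) * C"
      using C that by (intro \<open>\<And>e. e > 0 \<Longrightarrow> norm (D u v - D v u) \<le> e * C\<close>) simp
    also have "\<dots> \<le> e" using C that by (simp add: field_simps)
    finally show ?thesis by simp
  qed
  then have "norm (D u v - D v u) \<le> 0" using field_le_epsilon by blast
  then show ?thesis by (simp add: D_def)
qed

section \<open>Reflections\<close>

lemma dual_inner_commute: "dual_inner \<xi> \<eta> = dual_inner \<eta> \<xi>"
  by (simp add: dual_inner_def mult.commute)

lemma dual_inner_diff_left: "dual_inner (\<xi> - \<eta>) \<zeta> = dual_inner \<xi> \<zeta> - dual_inner \<eta> \<zeta>"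
  by (simp add: dual_inner_def blinfun.diff_left algebra_simps sum_subtractf)

lemma dual_inner_scaleR_left: "dual_inner (c *\<^sub>R \<xi>) \<zeta> = c * dual_inner \<xi> \<zeta>"
  by (simp add: dual_inner_def blinfun.scaleR_left sum_distrib_left algebra_simps)

lemma dual_inner_diff_right: "dual_inner \<zeta> (\<xi> - \<eta>) = dual_inner \<zeta> \<xi> - dual_inner \<zeta> \<eta>"
  by (simp add: dual_inner_commute[of \<zeta>] dual_inner_diff_left)

lemma dual_inner_scaleR_right: "dual_inner \<zeta> (c *\<^sub>R \<xi>) = c * dual_inner \<zeta> \<xi>"
  by (simp add: dual_inner_commute[of \<zeta>] dual_inner_scaleR_left)

lemma dual_inner_self_eq_0: "dual_inner \<alpha> \<alpha> = 0 \<longleftrightarrow> \<alpha> = 0"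
proof
  assume "dual_inner \<alpha> \<alpha> = 0"
  then have "\<forall>b\<in>Basis. blinfun_apply \<alpha> b = 0"
    unfolding dual_inner_def by (subst (asm) sum_nonneg_eq_0_iff) auto
  then show "\<alpha> = 0" by (auto intro: blinfun_euclidean_eqI)
qed (simp add: dual_inner_def)

lemma blinfun_apply_coroot_self: "\<alpha> \<noteq> 0 \<Longrightarrow> blinfun_apply \<alpha> (coroot \<alpha>) = 2"
  by (simp add: blinfun_apply_coroot dual_inner_self_eq_0)

lemma euclidean_eq_if_blinfun_eq:
  fixes x y :: "'a::euclidean_space"
  assumes "\<And>\<xi> :: 'a \<Rightarrow>\<^sub>L real. blinfun_apply \<xi> x = blinfun_apply \<xi> y"
  shows "x = y"
proof (rule euclidean_eqI)
  show "x \<bullet> b = y \<bullet> b" for b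
    using assms[of "blinfun_inner_left b"] by (simp add: inner_commute)
qed

text \<open>Reflection in \<alpha> is an isometry for \<open>dual_inner\<close>, so \<beta> and its
  mirror image have the same squared norm in the denominator of the coroot. It remains to compare
  numerators on each functional \<xi>.\<close>

lemma coroot_reflected:
  assumes "\<alpha> \<noteq> 0"
  shows "coroot (\<beta> - blinfun_apply \<beta> (coroot \<alpha>) *\<^sub>R \<alpha>) = lin_refl \<alpha> (coroot \<beta>)"
proof (rule euclidean_eq_if_blinfun_eq)
  fix \<xi>
  let ?\<gamma> = "\<beta> - blinfun_apply \<beta> (coroot \<alpha>) *\<^sub>R \<alpha>"
  define c where "c = blinfun_apply \<beta> (coroot \<alpha>)"
  have c: "c * dual_inner \<alpha> \<alpha> = 2 * dual_inner \<beta> \<alpha>"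
    using assms by (simp add: c_def blinfun_apply_coroot dual_inner_self_eq_0)
  have "dual_inner ?\<gamma> ?\<gamma> = dual_inner \<beta> \<beta> - 2 * c * dual_inner \<beta> \<alpha> + c * (c * dual_inner \<alpha> \<alpha>)"
    by (simp add: dual_inner_diff_left dual_inner_diff_right dual_inner_scaleR_left
        dual_inner_scaleR_right dual_inner_commute[of \<alpha> \<beta>] algebra_simps flip: c_def)
  then have *: "dual_inner ?\<gamma> ?\<gamma> = dual_inner \<beta> \<beta>"
    by (simp add: c)
  have "blinfun_apply \<xi> (coroot ?\<gamma>) = 2 * dual_inner \<xi> ?\<gamma> / dual_inner \<beta> \<beta>"
    by (simp only: blinfun_apply_coroot[of \<xi>] *)
  also have "\<dots> = 2 * (dual_inner \<xi> \<beta> - c * dual_inner \<xi> \<alpha>) / dual_inner \<beta> \<beta>"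
    by (simp add: dual_inner_diff_right dual_inner_scaleR_right c_def)
  also have "\<dots> = blinfun_apply \<xi> (coroot \<beta>) - (2 * dual_inner \<alpha> \<beta> / dual_inner \<beta> \<beta>) * (2 * dual_inner \<xi> \<alpha> / dual_inner \<alpha> \<alpha>)"
    by (simp add: c_def blinfun_apply_coroot dual_inner_commute[of \<alpha> \<beta>] diff_divide_distrib
        right_diff_distrib)
  also have "\<dots> = blinfun_apply \<xi> (lin_refl \<alpha> (coroot \<beta>))"
    by (simp add: lin_refl_def blinfun.diff_right blinfun.scaleR_right flip: blinfun_apply_coroot)
  finally show "blinfun_apply \<xi> (coroot ?\<gamma>) = blinfun_apply \<xi> (lin_refl \<alpha> (coroot \<beta>))" .
qed

lemma aff_aff_refl: "aff b (aff_refl a x) = aff b x - aff a x * blinfun_apply (fst b) (coroot (fst a))"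
  by (simp add: aff_def aff_refl_def blinfun.diff_right blinfun.scaleR_right)

lemma aff_self_aff_refl: "fst a \<noteq> 0 \<Longrightarrow> aff a (aff_refl a x) = - aff a x"
  by (simp add: aff_aff_refl blinfun_apply_coroot_self)

lemma aff_refl_aff_refl: "fst a \<noteq> 0 \<Longrightarrow> aff_refl a (aff_refl a x) = x"
  by (subst aff_refl_def) (simp add: aff_self_aff_refl, simp add: aff_refl_def)

text \<open>The reflection is an involution, so the inverse in \<open>act\<close> is the reflection
  itself.\<close>

lemma act_aff_refl: "fst a \<noteq> 0 \<Longrightarrow> act (aff_refl a) f x = f (aff_refl a x)"
  unfolding act_def by (metis aff_refl_aff_refl inv_equality)

lemma has_derivative_aff_refl: "(aff_refl a has_derivative lin_refl (fst a)) (at x)"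
proof -
  have "aff_refl a = (\<lambda>x. lin_refl (fst a) x - snd a *\<^sub>R coroot (fst a))"
    by (auto simp: aff_refl_def aff_def lin_refl_def scaleR_left_distrib)
  moreover have "bounded_linear (lin_refl (fst a))"
    unfolding lin_refl_def[abs_def]
    by (intro bounded_linear_sub bounded_linear_ident
        bounded_linear_scaleR_const[OF blinfun.bounded_linear_right])
  ultimately show ?thesis by (auto intro!: derivative_eq_intros bounded_linear_imp_has_derivative)
qed

lemma differentiable_comp_aff_refl:
  assumes "f differentiable (at (aff_refl a x))"
  shows "(\<lambda>y. f (aff_refl a y)) differentiable (at x)"
    and "dir_deriv v (\<lambda>y. f (aff_refl a y)) x = dir_deriv (lin_refl (fst a) v) f (aff_refl a x)"
proof -
  have *: "((\<lambda>y. f (aff_refl a y)) has_derivative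
      (\<lambda>v. dir_deriv (lin_refl (fst a) v) f (aff_refl a x))) (at x)"
    by (rule has_derivative_compose[OF has_derivative_aff_refl has_derivative_dir_deriv[OF assms]])
  then show "(\<lambda>y. f (aff_refl a y)) differentiable (at x)" by (rule differentiableI)
  show "dir_deriv v (\<lambda>y. f (aff_refl a y)) x = dir_deriv (lin_refl (fst a) v) f (aff_refl a x)"
    using dir_deriv_eq[OF *] by simp
qed

lemma lin_refl_lin_refl: "\<alpha> \<noteq> 0 \<Longrightarrow> lin_refl \<alpha> (lin_refl \<alpha> v) = v"
  by (simp add: lin_refl_def blinfun.diff_right blinfun.scaleR_right blinfun_apply_coroot_self algebra_simps)

text \<open>The action of s_a on affine functionals, written on pairs; \<open>aff_root_refl\<close>
  identifies it with composition with s_a.\<close>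

definition root_refl where
  "root_refl a b = b - blinfun_apply (fst b) (coroot (fst a)) *\<^sub>R a"
  for a b :: "('a::euclidean_space \<Rightarrow>\<^sub>L real) \<times> real"

lemma fst_root_refl: "fst (root_refl a b) = fst b - blinfun_apply (fst b) (coroot (fst a)) *\<^sub>R fst a"
  by (simp add: root_refl_def)

lemma aff_diff: "aff (b - c) x = aff b x - aff c x"
  by (simp add: aff_def blinfun.diff_left)

lemma aff_scaleR: "aff (r *\<^sub>R b) x = r * aff b x"
  by (simp add: aff_def blinfun.scaleR_left algebra_simps)

lemma aff_sum: "aff (\<Sum>i\<in>A. c i *\<^sub>R g i) x = (\<Sum>i\<in>A. c i * aff (g i) x)"
  by (simp add: aff_def fst_sum snd_sum blinfun.sum_left blinfun.scaleR_left
      distrib_left sum.distrib)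

lemma aff_root_refl: "fst a \<noteq> 0 \<Longrightarrow> aff (root_refl a b) x = aff b (aff_refl a x)"
  by (simp add: root_refl_def aff_diff aff_scaleR aff_aff_refl)

lemma root_refl_root_refl: "fst a \<noteq> 0 \<Longrightarrow> root_refl a (root_refl a b) = b"
  by (simp add: root_refl_def blinfun.diff_left blinfun.scaleR_left blinfun_apply_coroot_self
      algebra_simps)

lemma grad_root_refl:
  "blinfun_apply (fst (root_refl a b)) v = blinfun_apply (fst b) (lin_refl (fst a) v)"
  by (simp add: root_refl_def lin_refl_def blinfun.diff_left blinfun.scaleR_left
      blinfun.diff_right blinfun.scaleR_right)

text \<open>The conjugation relation s_{s_a b} = s_a s_b s_a, applied at the point s_a x. It rests
  on the linear part of s_a carrying the coroot of Db to the coroot of D(s_a b).\<close>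

lemma aff_refl_root_refl:
  assumes "fst a \<noteq> 0"
  shows "aff_refl (root_refl a b) (aff_refl a x) = aff_refl a (aff_refl b x)"
proof -
  have "aff_refl a (aff_refl b x) = aff_refl a x - aff b x *\<^sub>R lin_refl (fst a) (coroot (fst b))"
    by (simp add: aff_refl_def aff_def lin_refl_def blinfun.diff_right blinfun.scaleR_right
        blinfun.add_right algebra_simps)
  then show ?thesis
    by (simp add: aff_refl_def[of "root_refl a b"] aff_root_refl[OF assms]
        aff_refl_aff_refl[OF assms] fst_root_refl coroot_reflected[OF assms])
qed

section \<open>Positive affine roots\<close>

lemma nonneg_comb_add: "nonneg_comb B x \<Longrightarrow> nonneg_comb B y \<Longrightarrow> nonneg_comb B (x + y)"
proof -
  assume "nonneg_comb B x" "nonneg_comb B y"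
  then obtain c d :: "_ \<Rightarrow> nat"
    where "x = (\<Sum>b\<in>B. real (c b) *\<^sub>R b)" "y = (\<Sum>b\<in>B. real (d b) *\<^sub>R b)"
    by (auto simp: nonneg_comb_def)
  then have "x + y = (\<Sum>b\<in>B. real (c b + d b) *\<^sub>R b)"
    by (simp add: scaleR_left_distrib sum.distrib)
  then show ?thesis unfolding nonneg_comb_def by (intro exI[of _ "\<lambda>b. c b + d b"])
qed

lemma nonneg_comb_zero: "nonneg_comb B 0"
  unfolding nonneg_comb_def by (intro exI[of _ "\<lambda>_. 0"]) simp

lemma nonneg_comb_multiple: "nonneg_comb B x \<Longrightarrow> nonneg_comb B (real n *\<^sub>R x)"
  by (induction n) (auto simp: nonneg_comb_zero scaleR_left_distrib intro: nonneg_comb_add)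

lemma sum_if_mem:
  "finite A \<Longrightarrow> sum g A = sum g (A - {a}) + (if a \<in> A then g a else (0 :: 'b::comm_monoid_add))"
  by (simp add: sum.remove add.commute)

locale affine_root_datum =
  fixes R I0 :: "('a::euclidean_space \<Rightarrow>\<^sub>L real) set"
    and \<phi> :: "'a \<Rightarrow>\<^sub>L real"
    and k :: "('a \<Rightarrow>\<^sub>L real) \<times> real \<Rightarrow> real"
  assumes root_system: "root_system R" and reduced: "reduced_roots R"
    and crystallographic: "crystallographic R"
    and basis: "root_basis R I0" and highest: "highest_root R I0 \<phi>"
    and multiplicity: "multiplicity_function R k"
begin

abbreviation "\<Sigma> \<equiv> affine_roots R"
abbreviation "P \<equiv> affine_pos_roots R I0 \<phi>"
abbreviation "B \<equiv> affine_basis I0 \<phi>"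
abbreviation "V \<equiv> V_reg R I0 \<phi>"
abbreviation "D \<equiv> dunkl R I0 \<phi> k"

lemma finite_roots: "finite R"
  using root_system by (simp add: root_system_def)

lemma root_nonzero: "\<alpha> \<in> R \<Longrightarrow> \<alpha> \<noteq> 0"
  using root_system by (auto simp: root_system_def)

lemma root_uminus: assumes "\<alpha> \<in> R" shows "- \<alpha> \<in> R"
proof -
  have "\<alpha> - blinfun_apply \<alpha> (coroot \<alpha>) *\<^sub>R \<alpha> \<in> R"
    using root_system assms by (auto simp: root_system_def)
  then show ?thesis
    using root_nonzero[OF assms] by (simp add: blinfun_apply_coroot_self scaleR_2)
qed

lemma highest_in_roots: "\<phi> \<in> R"
  using highest by (simp add: highest_root_def)

lemma simple_in_roots: "I0 \<subseteq> R" and independent_simple: "independent I0"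
  using basis by (auto simp: root_basis_def)

lemma finite_simple: "finite I0"
  using finite_roots simple_in_roots finite_subset by blast

lemma grad_in_roots: "a \<in> \<Sigma> \<Longrightarrow> fst a \<in> R"
  by (auto simp: affine_roots_def)

lemma grad_nonzero: "a \<in> \<Sigma> \<Longrightarrow> fst a \<noteq> 0"
  using grad_in_roots root_nonzero by blast

lemma basis_in_affine_roots: "B \<subseteq> \<Sigma>"
  using simple_in_roots root_uminus[OF highest_in_roots]
  by (auto simp: affine_basis_def affine_roots_def)

lemma pos_in_affine_roots: "P \<subseteq> \<Sigma>"
  by (auto simp: affine_pos_roots_def)

lemma basis_in_pos: "B \<subseteq> P"
proof
  fix a assume a: "a \<in> B"
  have "finite B" using finite_simple by (simp add: affine_basis_def)
  have "(\<Sum>b\<in>B. real (if b = a then 1 else 0) *\<^sub>R b) = (\<Sum>b\<in>B. if b = a then b else 0)"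
    by (rule sum.cong) auto
  then have "nonneg_comb B a"
    unfolding nonneg_comb_def using a \<open>finite B\<close> by (intro exI[of _ "\<lambda>b. if b = a then 1 else 0"]) simp
  then show "a \<in> P" using a basis_in_affine_roots by (auto simp: affine_pos_roots_def)
qed

lemma affine_root_uminus: "a \<in> \<Sigma> \<Longrightarrow> - a \<in> \<Sigma>"
  using root_uminus by (auto simp: affine_roots_def)

text \<open>Integrality of the root-coroot pairings keeps the constant term an integer.\<close>

lemma affine_root_refl: "a \<in> \<Sigma> \<Longrightarrow> b \<in> \<Sigma> \<Longrightarrow> root_refl a b \<in> \<Sigma>"
  using root_system crystallographic
  by (auto simp: root_refl_def affine_roots_def root_system_def crystallographic_def
      intro!: Ints_diff Ints_mult)

lemma finite_basis: "finite B"
  using finite_simple by (simp add: affine_basis_def)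

lemma sum_basis: "(\<Sum>b\<in>B. g b) = g (- \<phi>, 1) + (\<Sum>\<alpha>\<in>I0. g (\<alpha>, 0))"
  for g :: "_ \<Rightarrow> 'b::comm_monoid_add"
proof -
  have "(\<Sum>b\<in>I0 \<times> {0}. g b) = (\<Sum>\<alpha>\<in>I0. g (\<alpha>, 0))"
    by (rule sum.reindex_bij_witness[of _ "\<lambda>\<alpha>. (\<alpha>, 0)" fst]) auto
  then show ?thesis using finite_simple by (simp add: affine_basis_def)
qed

lemma simple_independentD:
  assumes "(\<Sum>\<alpha>\<in>I0. c \<alpha> *\<^sub>R \<alpha>) = 0" "\<alpha> \<in> I0" shows "c \<alpha> = 0"
  using independentD[OF independent_simple finite_simple order_refl] assms by blast

text \<open>Only a_0 has a nonzero constant term, so its coefficient vanishes first; the gradients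
  then give a relation among the simple roots.\<close>

lemma basis_independentD:
  assumes "(\<Sum>b\<in>B. c b *\<^sub>R b) = 0" "b \<in> B"
  shows "c b = 0"
proof -
  have "snd (\<Sum>b\<in>B. c b *\<^sub>R b) = 0" "fst (\<Sum>b\<in>B. c b *\<^sub>R b) = 0" using assms by auto
  then have 0: "c (- \<phi>, 1) = 0" and 1: "(\<Sum>\<alpha>\<in>I0. c (\<alpha>, 0) *\<^sub>R \<alpha>) = 0"
    by (auto simp: sum_basis fst_sum snd_sum)
  then show ?thesis
    using assms(2) simple_independentD[OF 1] by (auto simp: affine_basis_def)
qed

text \<open>Otherwise -\<phi> is a nonnegative combination. So is \<phi> - (-\<phi>), as \<phi>
  dominates -\<phi>. Adding -\<phi> twice to the latter gives 0, so all coefficients vanish and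
  \<phi> = 0.\<close>

lemma highest_nonneg: "nonneg_comb I0 \<phi>"
proof (rule ccontr)
  assume "\<not> nonneg_comb I0 \<phi>"
  then have "nonneg_comb I0 (- \<phi>)"
    using basis highest_in_roots by (auto simp: root_basis_def)
  then obtain c :: "_ \<Rightarrow> nat" where c: "- \<phi> = (\<Sum>b\<in>I0. real (c b) *\<^sub>R b)"
    by (auto simp: nonneg_comb_def)
  have "nonneg_comb I0 (\<phi> - - \<phi>)"
    using highest root_uminus[OF highest_in_roots] by (auto simp: highest_root_def)
  then obtain d :: "_ \<Rightarrow> nat" where d: "\<phi> - - \<phi> = (\<Sum>b\<in>I0. real (d b) *\<^sub>R b)"
    by (auto simp: nonneg_comb_def)
  have "(\<Sum>b\<in>I0. real (c b + c b + d b) *\<^sub>R b) = - \<phi> + - \<phi> + (\<phi> - - \<phi>)"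
    unfolding d unfolding c by (simp only: of_nat_add scaleR_left_distrib sum.distrib)
  also have "\<dots> = 0" by simp
  finally have "real (c b + c b + d b) = 0" if "b \<in> I0" for b
    by (rule simple_independentD[OF _ that])
  then have "- \<phi> = 0" unfolding c by (intro sum.neutral) (auto simp flip: of_nat_add)
  then show False using root_nonzero[OF highest_in_roots] by simp
qed

lemma nonneg_comb_affine_basis:
  assumes "nonneg_comb I0 \<gamma>"
  shows "nonneg_comb B (\<gamma> - real n *\<^sub>R \<phi>, real n)"
proof -
  obtain c :: "_ \<Rightarrow> nat" where c: "\<gamma> = (\<Sum>b\<in>I0. real (c b) *\<^sub>R b)"
    using assms by (auto simp: nonneg_comb_def)
  \<comment> \<open>The pair equals \<gamma> + n a_0. The test \<open>snd b = 1\<close> singles out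
    a_0, since the simple roots have constant term 0.\<close>
  let ?c = "\<lambda>b. if snd b = 1 then n else c (fst b)"
  have "(\<Sum>b\<in>B. real (?c b) *\<^sub>R b) = (\<gamma> - real n *\<^sub>R \<phi>, real n)"
    by (rule prod_eqI) (simp_all add: sum_basis fst_sum snd_sum c)
  from this[symmetric] show ?thesis unfolding nonneg_comb_def by (rule exI[of _ ?c])
qed

text \<open>Write \<alpha> + m = m a_0 + (m - 1) \<phi> + (\<phi> - (-\<alpha>)). One copy of \<phi>
  dominates -\<alpha>, and the m - 1 others are nonnegative themselves.\<close>

lemma pos_if_level_pos:
  assumes "\<alpha> \<in> R" "m > 0"
  shows "(\<alpha>, real_of_int m) \<in> P"
proof -
  define n where "n = nat (m - 1)"
  have m: "real_of_int m = real (Suc n)" using assms by (simp add: n_def)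
  have "nonneg_comb I0 (\<phi> - - \<alpha>)"
    using highest root_uminus[OF assms(1)] by (auto simp: highest_root_def)
  then have "nonneg_comb I0 (real n *\<^sub>R \<phi> + (\<phi> - - \<alpha>))"
    by (intro nonneg_comb_add nonneg_comb_multiple highest_nonneg)
  from nonneg_comb_affine_basis[OF this, of "Suc n"] have "nonneg_comb B (\<alpha>, real (Suc n))"
    by (simp add: scaleR_left_distrib)
  then have "nonneg_comb B (\<alpha>, real_of_int m)" by (simp only: m)
  then show ?thesis
    using assms by (simp add: affine_pos_roots_def affine_roots_def)
qed

text \<open>The sign of the constant term decides; at level 0 the dichotomy is that of the finite
  root basis.\<close>

lemma pos_or_neg:
  assumes "a \<in> \<Sigma>"
  shows "a \<in> P \<or> - a \<in> P"
proof -
  obtain \<alpha> m where a: "a = (\<alpha>, real_of_int m)" "\<alpha> \<in> R"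
    using assms by (auto simp: affine_roots_def elim!: Ints_cases)
  consider "m > 0" | "- m > 0" | "m = 0" by linarith
  then show ?thesis
  proof cases
    case 1 then show ?thesis using pos_if_level_pos a by simp
  next
    case 2 then show ?thesis using pos_if_level_pos[OF root_uminus 2] a by simp
  next
    case 3
    have "nonneg_comb I0 \<alpha> \<or> nonneg_comb I0 (- \<alpha>)" using basis a by (auto simp: root_basis_def)
    then have "nonneg_comb B a \<or> nonneg_comb B (- a)"
      using nonneg_comb_affine_basis[of _ 0] a 3 by auto
    then show ?thesis using assms affine_root_uminus by (auto simp: affine_pos_roots_def)
  qed
qed

text \<open>The reflection s_a changes only the coefficient of a. Some other simple root occurs in b
  with positive coefficient, and this coefficient survives, so s_a b can be neither negative nor
  equal to a.\<close>

lemma simple_refl_pos: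
  assumes a: "a \<in> B" and b: "b \<in> P" "b \<noteq> a"
  shows "root_refl a b \<in> P - {a}"
proof -
  obtain c :: "_ \<Rightarrow> nat" where c: "b = (\<Sum>i\<in>B. real (c i) *\<^sub>R i)"
    using b by (auto simp: affine_pos_roots_def nonneg_comb_def)
  \<comment> \<open>Otherwise b is a multiple of a. Comparing gradients in the reduced system makes
    the factor 1 or -1, and as a natural number it is 1, so b = a.\<close>
  have "\<exists>i\<in>B - {a}. c i \<noteq> 0"
  proof (rule ccontr)
    assume "\<not> ?thesis"
    then have "b = real (c a) *\<^sub>R a"
      using a finite_basis c by (simp add: sum.remove)
    moreover have "fst b \<in> R" "fst a \<in> R"
      using a b basis_in_affine_roots pos_in_affine_roots grad_in_roots by blast+
    ultimately have "real (c a) = 1 \<or> real (c a) = - 1"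
      using reduced unfolding reduced_roots_def by (metis fst_scaleR)
    then have "real (c a) = 1" by linarith
    with \<open>b = real (c a) *\<^sub>R a\<close> b show False by simp
  qed
  then obtain i where i: "i \<in> B" "i \<noteq> a" "c i > 0" by auto
  define N where "N = blinfun_apply (fst b) (coroot (fst a))"
  \<comment> \<open>The coefficients of s_a b in the affine basis; they agree with \<open>c\<close>
    away from a.\<close>
  define e where "e j = real (c j) - (if j = a then N else 0)" for j
  have "(\<Sum>j\<in>B. (if j = a then N else 0) *\<^sub>R j) = (\<Sum>j\<in>B. if j = a then N *\<^sub>R a else 0)"
    by (rule sum.cong) auto
  then have e: "root_refl a b = (\<Sum>j\<in>B. e j *\<^sub>R j)"
    using a finite_basis by (simp add: root_refl_def e_def N_def[symmetric] scaleR_left_diff_distrib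
        sum_subtractf c[symmetric])
  have root: "root_refl a b \<in> \<Sigma>"
    using a b basis_in_affine_roots pos_in_affine_roots affine_root_refl by blast
  have "- root_refl a b \<notin> P"
  proof
    assume "- root_refl a b \<in> P"
    then obtain d :: "_ \<Rightarrow> nat" where d: "- root_refl a b = (\<Sum>i\<in>B. real (d i) *\<^sub>R i)"
      by (auto simp: affine_pos_roots_def nonneg_comb_def)
    have "(\<Sum>j\<in>B. (e j + real (d j)) *\<^sub>R j) = root_refl a b + - root_refl a b"
      unfolding d unfolding e by (simp add: scaleR_left_distrib sum.distrib)
    then have "(\<Sum>j\<in>B. (e j + real (d j)) *\<^sub>R j) = 0" by simp
    from basis_independentD[OF this i(1)] i show False by (simp add: e_def)
  qed
  then have "root_refl a b \<in> P" using pos_or_neg[OF root] by blast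
  moreover have "root_refl a b \<noteq> a"
  proof
    assume eq: "root_refl a b = a"
    have "(\<Sum>j\<in>B. (if j = a then 1 else 0) *\<^sub>R j) = (\<Sum>j\<in>B. if j = a then a else 0)"
      by (rule sum.cong) auto
    then have "(\<Sum>j\<in>B. (e j - (if j = a then 1 else 0)) *\<^sub>R j) = root_refl a b - a"
      unfolding e using a finite_basis by (simp add: scaleR_left_diff_distrib sum_subtractf)
    then have "(\<Sum>j\<in>B. (e j - (if j = a then 1 else 0)) *\<^sub>R j) = 0" by (simp add: eq)
    from basis_independentD[OF this i(1)] i show False by (simp add: e_def)
  qed
  ultimately show ?thesis by blast
qed

lemma multiplicity_root_refl:
  assumes "a \<in> \<Sigma>" "b \<in> \<Sigma>"
  shows "k (root_refl a b) = k b"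
proof -
  have "aff_refl a \<in> affine_weyl_group R"
    unfolding affine_weyl_group_def using assms by (intro generate.incl) auto
  moreover have "aff (root_refl a b) = act (aff_refl a) (aff b)"
    using grad_nonzero[OF assms(1)] by (auto simp: aff_root_refl act_aff_refl)
  ultimately show ?thesis
    using multiplicity assms affine_root_refl[OF assms] unfolding multiplicity_function_def by blast
qed

section \<open>Regular points\<close>

text \<open>\<open>V_reg\<close> removes the hyperplanes of positive roots, but a and -a share a
  hyperplane and one of them is positive.\<close>

lemma regular_nonzero:
  assumes "x \<in> V" "a \<in> \<Sigma>" shows "aff a x \<noteq> 0"
proof
  assume 0: "aff a x = 0"
  then have "aff (- a) x = 0" by (simp add: aff_def blinfun.minus_left)
  with 0 show False using assms pos_or_neg[OF assms(2)] by (auto simp: V_reg_def)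
qed

lemma regular_aff_refl:
  assumes "x \<in> V" "a \<in> \<Sigma>" shows "aff_refl a x \<in> V"
proof -
  have "aff b (aff_refl a x) \<noteq> 0" if "b \<in> P" for b
    using regular_nonzero[OF assms(1) affine_root_refl[OF assms(2), of b]] that pos_in_affine_roots
      grad_nonzero[OF assms(2)] by (auto simp: aff_root_refl)
  then show ?thesis by (auto simp: V_reg_def)
qed

text \<open>For regular x these roots label the hyperplanes separating x from the fundamental
  alcove. They index the sum in \<open>dunkl\<close> at x.\<close>

definition S where "S x = {a \<in> P. aff a x < 0}"

lemma S_in_affine_roots: "a \<in> S x \<Longrightarrow> a \<in> \<Sigma>"
  unfolding S_def using pos_in_affine_roots by blast

lemma S_eq_chi: "S x = {a \<in> P. chi a x \<noteq> 0}"
  by (auto simp: S_def chi_def)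

lemma finite_S: "finite (S x)"
  unfolding S_eq_chi by (rule finite_chi_support[OF finite_roots])

text \<open>Only finitely many positive roots take a nonpositive value somewhere on the unit ball
  around x, and each of these keeps its sign near x. This fixes the index set of the Dunkl sum while
  it is differentiated.\<close>

lemma S_locally_constant:
  assumes "x \<in> V"
  obtains U where "open U" "x \<in> U" "U \<subseteq> V" "\<And>y. y \<in> U \<Longrightarrow> S y = S x"
proof -
  define F where "F = P \<inter> (SIGMA \<alpha>:R. real_of_int ` {0..\<lceil>norm \<alpha> * (norm x + 1)\<rceil>})"
  have "finite F" using finite_roots by (auto simp: F_def)
  \<comment> \<open>The nonstrict inequality also covers roots vanishing at y, which is what later
    puts U inside V.\<close>
  have F: "a \<in> F" if "a \<in> P" "aff a y \<le> 0" "y \<in> ball x 1" for a y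
  proof -
    have "a \<in> \<Sigma>" using that(1) pos_in_affine_roots by blast
    then obtain \<alpha> m where a: "a = (\<alpha>, real_of_int m)" "\<alpha> \<in> R"
      by (auto simp: affine_roots_def elim!: Ints_cases)
    have "norm y \<le> norm x + 1"
      using that norm_triangle_ineq2[of y x] by (simp add: dist_norm norm_minus_commute)
    then have "norm \<alpha> * norm y \<le> norm \<alpha> * (norm x + 1)" by (intro mult_left_mono) auto
    moreover have "\<bar>blinfun_apply \<alpha> y\<bar> \<le> norm \<alpha> * norm y"
      using norm_blinfun[of \<alpha> y] by simp
    ultimately have "real_of_int m \<le> norm \<alpha> * (norm x + 1)"
      using that a by (simp add: aff_def)
    then have "m \<le> \<lceil>norm \<alpha> * (norm x + 1)\<rceil>" by linarith
    moreover have "0 \<le> m" using affine_pos_roots_snd_nonneg[OF that(1)] a by simp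
    ultimately show ?thesis using that a by (auto simp: F_def)
  qed
  define U where "U = ball x 1 \<inter> (\<Inter>a\<in>F. {y. aff a x * aff a y > 0})"
  have "open {y. aff a x * aff a y > 0}" for a
    unfolding aff_def by (intro open_Collect_less continuous_intros)
  then have "open U" using \<open>finite F\<close> unfolding U_def by (intro open_Int open_ball open_INT) blast+
  moreover have "aff a x * aff a x > 0" if "a \<in> F" for a
    using regular_nonzero[OF assms, of a] that pos_in_affine_roots
    by (auto simp: F_def zero_less_mult_iff)
  then have "x \<in> U" by (auto simp: U_def)
  moreover have "U \<subseteq> V"
  proof
    fix y assume y: "y \<in> U"
    have "aff a y \<noteq> 0" if "a \<in> P" for a
    proof
      assume 0: "aff a y = 0"
      then have "a \<in> F" using F[OF that, of y] y by (simp add: U_def)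
      then show False using y 0 by (auto simp: U_def)
    qed
    then show "y \<in> V" by (auto simp: V_reg_def)
  qed
  moreover have "S y = S x" if "y \<in> U" for y
  proof -
    have "aff a y < 0 \<longleftrightarrow> aff a x < 0" if a: "a \<in> P" for a
    proof (cases "a \<in> F")
      case True
      then show ?thesis using \<open>y \<in> U\<close> by (auto simp: U_def zero_less_mult_iff)
    next
      case False
      then have "\<not> aff a y \<le> 0" "\<not> aff a x \<le> 0"
        using F[OF a, of x] F[OF a, of y] \<open>y \<in> U\<close> by (auto simp: U_def)
      then show ?thesis by linarith
    qed
    then show ?thesis by (auto simp: S_def)
  qed
  ultimately show thesis by (rule that)
qed

lemma open_regular: "open V"
  by (rule openI) (metis S_locally_constant openE order_trans)

text \<open>The permutation of positive roots by s_a transports values along the point reflection.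
  One inclusion is shown at an arbitrary point; the other is the same inclusion at s_a x, because
  s_a is an involution.\<close>

lemma S_aff_refl:
  assumes a: "a \<in> B"
  shows "S (aff_refl a x) - {a} = root_refl a ` (S x - {a})"
proof -
  have a0: "fst a \<noteq> 0" using a basis_in_affine_roots grad_nonzero by blast
  have *: "root_refl a b \<in> S (aff_refl a y) - {a}" if "b \<in> S y - {a}" for b y
    using simple_refl_pos[OF a, of b] that by (simp add: S_def aff_root_refl a0 aff_refl_aff_refl)
  show ?thesis
  proof (intro equalityI subsetI)
    fix b assume "b \<in> S (aff_refl a x) - {a}"
    from *[OF this] have "root_refl a b \<in> S x - {a}" by (simp only: aff_refl_aff_refl[OF a0])
    from imageI[OF this, of "root_refl a"] show "b \<in> root_refl a ` (S x - {a})"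
      by (simp only: root_refl_root_refl[OF a0])
  next
    fix b assume "b \<in> root_refl a ` (S x - {a})"
    then obtain c where "b = root_refl a c" "c \<in> S x - {a}" by (rule imageE)
    then show "b \<in> S (aff_refl a x) - {a}" using *[of c x] by simp
  qed
qed

lemma exists_simple_negative:
  assumes "S x \<noteq> {}"
  shows "\<exists>a\<in>B. aff a x < 0"
proof (rule ccontr)
  assume *: "\<not> ?thesis"
  obtain b where b: "b \<in> P" "aff b x < 0" using assms by (auto simp: S_def)
  then obtain c :: "_ \<Rightarrow> nat" where "b = (\<Sum>i\<in>B. real (c i) *\<^sub>R i)"
    by (auto simp: affine_pos_roots_def nonneg_comb_def)
  then have "aff b x = (\<Sum>i\<in>B. real (c i) * aff i x)" by (simp add: aff_sum)
  also have "\<dots> \<ge> 0" using * by (intro sum_nonneg mult_nonneg_nonneg) auto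
  finally show False using b by simp
qed

text \<open>The root a drops out of the set, and the remaining roots are the images of those in
  \<open>S x - {a}\<close>.\<close>

lemma card_S_aff_refl:
  assumes a: "a \<in> B" "aff a x < 0"
  shows "card (S (aff_refl a x)) < card (S x)"
proof -
  have a0: "fst a \<noteq> 0" using a basis_in_affine_roots grad_nonzero by blast
  have "a \<notin> S (aff_refl a x)" using a by (simp add: S_def aff_self_aff_refl a0)
  then have "S (aff_refl a x) = root_refl a ` (S x - {a})" using S_aff_refl[OF a(1)] by auto
  then have "card (S (aff_refl a x)) \<le> card (S x - {a})"
    using finite_S card_image_le by (metis finite_Diff)
  also have "\<dots> < card (S x)"
    using a basis_in_pos finite_S by (intro psubset_card_mono) (auto simp: S_def)
  finally show ?thesis .
qed

section \<open>Dunkl operators\<close>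

lemma dunkl_eq:
  "D v f x = dir_deriv v f x +
    (\<Sum>a\<in>S x. complex_of_real (k a * blinfun_apply (fst a) v) * f (aff_refl a x))"
proof -
  have "(\<Sum>a\<in>S x. complex_of_real (k a * blinfun_apply (fst a) v * chi a x) * act (aff_refl a) f x)
      = (\<Sum>a\<in>S x. complex_of_real (k a * blinfun_apply (fst a) v) * f (aff_refl a x))"
  proof (rule sum.cong)
    fix a assume a: "a \<in> S x"
    then have "chi a x = 1" by (simp add: S_def chi_def)
    moreover have "fst a \<noteq> 0" by (rule grad_nonzero[OF S_in_affine_roots[OF a]])
    ultimately show "complex_of_real (k a * blinfun_apply (fst a) v * chi a x) * act (aff_refl a) f x
        = complex_of_real (k a * blinfun_apply (fst a) v) * f (aff_refl a x)"
      by (simp add: act_aff_refl)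
  qed simp
  then show ?thesis unfolding dunkl_def S_eq_chi by simp
qed

text \<open>The derivative is local in the open set V, and reflections map V to itself, so values
  off V never enter.\<close>

lemma dunkl_cong:
  assumes "x \<in> V" "\<And>y. y \<in> V \<Longrightarrow> f y = g y"
  shows "D v f x = D v g x"
proof -
  have "dir_deriv v f x = dir_deriv v g x"
    by (rule dir_deriv_cong_open[OF open_regular assms])
  moreover have "f (aff_refl a x) = g (aff_refl a x)" if "a \<in> S x" for a
    by (rule assms(2)[OF regular_aff_refl[OF assms(1) S_in_affine_roots[OF that]]])
  ultimately show ?thesis by (simp add: dunkl_eq)
qed

lemma dunkl_add:
  assumes "f differentiable (at x)" "g differentiable (at x)"
  shows "D v (\<lambda>y. f y + g y) x = D v f x + D v g x"
  using dir_deriv_eq[OF has_derivative_add[OF assms[THEN has_derivative_dir_deriv]]]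
  by (simp add: dunkl_eq distrib_left sum.distrib)

lemma dunkl_mult:
  assumes "f differentiable (at x)"
  shows "D v (\<lambda>y. c * f y) x = c * D v f x"
  using dir_deriv_eq[OF has_derivative_mult_right[OF has_derivative_dir_deriv[OF assms], of c]]
  by (simp add: dunkl_eq distrib_left sum_distrib_left mult_ac)

text \<open>The operator is linear in its direction, here applied to v - \<alpha>(v) times the
  coroot.\<close>

lemma dunkl_lin_refl:
  assumes "f differentiable (at x)"
  shows "D (lin_refl \<alpha> v) f x = D v f x - complex_of_real (blinfun_apply \<alpha> v) * D (coroot \<alpha>) f x"
proof -
  have lin: "linear (\<lambda>v. dir_deriv v f x)"
    by (rule has_derivative_linear[OF has_derivative_dir_deriv[OF assms]])
  have "dir_deriv (lin_refl \<alpha> v) f x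
      = dir_deriv v f x - complex_of_real (blinfun_apply \<alpha> v) * dir_deriv (coroot \<alpha>) f x"
    unfolding lin_refl_def linear_diff[OF lin] linear_scale[OF lin]
    by (simp add: scaleR_conv_of_real)
  then show ?thesis
    by (simp add: dunkl_eq lin_refl_def blinfun.diff_right blinfun.scaleR_right
        algebra_simps sum_subtractf sum_distrib_left)
qed

text \<open>For a simple \<open>a\<close> the terms of the two sums correspond under the permutation \<open>s\<^sub>a\<close> of the
  positive roots other than \<open>a\<close>. The term of \<open>a\<close> occurs in exactly one of the sums, depending
  on the side of the wall, and it yields the multiple of \<open>f\<close>.\<close>

lemma cross_relation:
  assumes a: "a \<in> B" and x: "x \<in> V" and f: "f differentiable (at (aff_refl a x))"
  shows "D v f (aff_refl a x) = D (lin_refl (fst a) v) (\<lambda>y. f (aff_refl a y)) x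
    + complex_of_real (k a * blinfun_apply (fst a) v) * f x"
proof -
  let ?v = "lin_refl (fst a) v" and ?K = "complex_of_real (k a * blinfun_apply (fst a) v)"
  let ?g = "\<lambda>b. complex_of_real (k b * blinfun_apply (fst b) v) * f (aff_refl b (aff_refl a x))"
  let ?h = "\<lambda>b. complex_of_real (k b * blinfun_apply (fst b) ?v) * f (aff_refl a (aff_refl b x))"
  have a\<Sigma>: "a \<in> \<Sigma>" and aP: "a \<in> P" using a basis_in_affine_roots basis_in_pos by blast+
  have a0: "fst a \<noteq> 0" using a\<Sigma> grad_nonzero by blast
  have "sum ?g (S (aff_refl a x) - {a}) = sum ?g (root_refl a ` (S x - {a}))"
    by (simp only: S_aff_refl[OF a])
  also have "\<dots> = (\<Sum>b\<in>S x - {a}. ?g (root_refl a b))"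
    by (rule sum.reindex_cong[OF _ refl refl]) (metis inj_onI root_refl_root_refl a0)
  also have "\<dots> = sum ?h (S x - {a})"
  proof (rule sum.cong)
    fix b assume "b \<in> S x - {a}"
    then have "k (root_refl a b) = k b"
      using multiplicity_root_refl[OF a\<Sigma> S_in_affine_roots] by blast
    then show "?g (root_refl a b) = ?h b"
      by (simp add: aff_refl_root_refl[OF a0] grad_root_refl)
  qed simp
  finally have eq: "sum ?g (S (aff_refl a x) - {a}) = sum ?h (S x - {a})" .
  have ga: "?g a = ?K * f x" by (simp add: aff_refl_aff_refl[OF a0])
  have "blinfun_apply (fst a) ?v = - blinfun_apply (fst a) v"
    by (simp add: lin_refl_def blinfun.diff_right blinfun.scaleR_right blinfun_apply_coroot_self[OF a0])
  then have ha: "?h a = - (?K * f x)" by (simp add: aff_refl_aff_refl[OF a0])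
  have "a \<in> S (aff_refl a x) \<longleftrightarrow> aff a x > 0" "a \<in> S x \<longleftrightarrow> aff a x < 0"
    using aP by (auto simp: S_def aff_self_aff_refl[OF a0])
  then have "a \<in> S (aff_refl a x) \<longleftrightarrow> a \<notin> S x"
    using regular_nonzero[OF x a\<Sigma>] by linarith
  then have "sum ?g (S (aff_refl a x)) = sum ?h (S x) + ?K * f x"
    unfolding sum_if_mem[OF finite_S, of ?g _ a] sum_if_mem[OF finite_S, of ?h _ a] eq ga ha by simp
  \<comment> \<open>The derivative terms agree: composition with s_a turns the direction s_{Da} v
    back into v.\<close>
  then show ?thesis
    unfolding dunkl_eq differentiable_comp_aff_refl(2)[OF f] lin_refl_lin_refl[OF a0] by simp
qed

text \<open>Two derivatives suffice for a commutator of first-order operators. The class is stable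
  under composition with the reflections, as the induction requires.\<close>

definition twice_differentiable :: "('a \<Rightarrow> complex) \<Rightarrow> bool" where
  "twice_differentiable f \<longleftrightarrow>
     (\<forall>x\<in>V. f differentiable (at x) \<and> (\<forall>v. dir_deriv v f differentiable (at x)))"

lemma twice_differentiable_if_C_infinity:
  assumes "f \<in> C_infinity V" shows "twice_differentiable f"
proof -
  have "times_cont_diff_on (Suc (Suc 0)) V f" using assms unfolding C_infinity_def by blast
  then show ?thesis by (simp add: twice_differentiable_def)
qed

lemma differentiable_cong_open:
  assumes "f differentiable (at x)" "open U" "x \<in> U" "\<And>y. y \<in> U \<Longrightarrow> f y = g y"
  shows "g differentiable (at x)"
  using assms unfolding differentiable_def by (metis has_derivative_transform_within_open)

lemma twice_differentiable_aff_refl: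
  assumes f: "twice_differentiable f" and a: "a \<in> \<Sigma>"
  shows "twice_differentiable (\<lambda>y. f (aff_refl a y))"
  unfolding twice_differentiable_def
proof (intro ballI conjI allI)
  fix x v assume x: "x \<in> V"
  have d: "f differentiable (at (aff_refl a y))" if "y \<in> V" for y
    using f regular_aff_refl[OF that a] by (simp add: twice_differentiable_def)
  show "(\<lambda>y. f (aff_refl a y)) differentiable (at x)"
    by (rule differentiable_comp_aff_refl(1)[OF d[OF x]])
  have "(\<lambda>y. dir_deriv (lin_refl (fst a) v) f (aff_refl a y)) differentiable (at x)"
    using f regular_aff_refl[OF x a]
    by (intro differentiable_comp_aff_refl(1)) (simp add: twice_differentiable_def)
  \<comment> \<open>The chain rule identifies the two functions on V only, so differentiability is
    transferred through the open set V.\<close>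
  then show "dir_deriv v (\<lambda>y. f (aff_refl a y)) differentiable (at x)"
    by (rule differentiable_cong_open[OF _ open_regular x])
      (simp add: differentiable_comp_aff_refl(2)[OF d])
qed

text \<open>Near x the index set is the constant \<open>S x\<close>, so the operator yields a fixed
  finite sum of differentiable functions. The cross relation can therefore be applied to
  \<open>D v f\<close> itself.\<close>

lemma dunkl_differentiable:
  assumes f: "twice_differentiable f" and x: "x \<in> V"
  shows "D v f differentiable (at x)"
proof -
  obtain U where U: "open U" "x \<in> U" "U \<subseteq> V" "\<And>y. y \<in> U \<Longrightarrow> S y = S x"
    using S_locally_constant[OF x] by blast
  have "(\<lambda>y. f (aff_refl a y)) differentiable (at x)" if "a \<in> S x" for a
    using twice_differentiable_aff_refl[OF f S_in_affine_roots[OF that]] x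
    by (simp add: twice_differentiable_def)
  then have "(\<lambda>y. dir_deriv v f y +
      (\<Sum>a\<in>S x. complex_of_real (k a * blinfun_apply (fst a) v) * f (aff_refl a y)))
      differentiable (at x)"
    using f x finite_S
    by (intro differentiable_add differentiable_sum differentiable_mult differentiable_const)
      (auto simp: twice_differentiable_def)
  then show ?thesis
    by (rule differentiable_cong_open[OF _ U(1,2)]) (simp add: dunkl_eq U(4))
qed

lemma dunkl_commute_fundamental_alcove:
  assumes f: "twice_differentiable f" and x: "x \<in> V" "S x = {}"
  shows "D u (D v f) x = D v (D u f) x"
proof -
  obtain U where U: "open U" "x \<in> U" "U \<subseteq> V" "\<And>y. y \<in> U \<Longrightarrow> S y = S x"
    using S_locally_constant[OF x(1)] by blast
  have "D u (D v f) x = dir_deriv u (dir_deriv v f) x" for u v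
  proof -
    \<comment> \<open>Differentiating the inner operator requires the sum to be empty on a whole
      neighbourhood of x, which U provides.\<close>
    have "dir_deriv u (D v f) x = dir_deriv u (dir_deriv v f) x"
      by (rule dir_deriv_cong_open[OF U(1,2)]) (simp add: dunkl_eq U(4) x)
    then show ?thesis by (simp add: dunkl_eq[of u] x)
  qed
  moreover have "dir_deriv u (dir_deriv v f) x = dir_deriv v (dir_deriv u f) x"
    using f x by (intro dir_deriv_commute[OF open_regular]) (auto simp: twice_differentiable_def)
  ultimately show ?thesis by simp
qed

text \<open>By the cross relation the commutator of \<open>D u\<close> and \<open>D v\<close> is carried by \<open>s\<^sub>a\<close> to that of
  \<open>D (s\<^sub>a u)\<close> and \<open>D (s\<^sub>a v)\<close>: the first-order terms that arise are symmetric in \<open>u\<close> and \<open>v\<close>.\<close>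

lemma dunkl_commute_aff_refl:
  assumes a: "a \<in> B" and x: "x \<in> V" and f: "twice_differentiable f"
    and comm: "\<And>u v g. twice_differentiable g \<Longrightarrow> D u (D v g) x = D v (D u g) x"
  shows "D u (D v f) (aff_refl a x) = D v (D u f) (aff_refl a x)"
proof -
  let ?s = "lin_refl (fst a)" and ?c = "\<lambda>v. complex_of_real (blinfun_apply (fst a) v)"
  let ?f = "\<lambda>y. f (aff_refl a y)"
  have a\<Sigma>: "a \<in> \<Sigma>" using a basis_in_affine_roots by blast
  have f': "twice_differentiable ?f" by (rule twice_differentiable_aff_refl[OF f a\<Sigma>])
  have df: "f differentiable (at y)" if "y \<in> V" for y
    using f that by (simp add: twice_differentiable_def)
  have *: "D u (D v f) (aff_refl a x) = D (?s u) (D (?s v) ?f) x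
      + k a * (?c v * D u f x + ?c u * D v f x - ?c u * ?c v * D (coroot (fst a)) f x)" for u v
  proof -
    have "D u (D v f) (aff_refl a x) = D (?s u) (\<lambda>y. D v f (aff_refl a y)) x
        + k a * ?c u * D v f x"
      using cross_relation[OF a x dunkl_differentiable[OF f regular_aff_refl[OF x a\<Sigma>]]] by simp
    also have "D (?s u) (\<lambda>y. D v f (aff_refl a y)) x
        = D (?s u) (\<lambda>y. D (?s v) ?f y + k a * ?c v * f y) x"
      \<comment> \<open>The cross relation is used a second time, now for f under the outer
        operator; it holds at points of V, hence the passage through
        \<open>dunkl_cong\<close>.\<close>
      using cross_relation[OF a _ df[OF regular_aff_refl[OF _ a\<Sigma>]], of _ v]
      by (intro dunkl_cong[OF x]) simp
    also have "\<dots> = D (?s u) (D (?s v) ?f) x + D (?s u) (\<lambda>y. k a * ?c v * f y) x"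
      using dunkl_differentiable[OF f' x] df[OF x]
      by (intro dunkl_add) (auto intro: differentiable_mult)
    also have "D (?s u) (\<lambda>y. k a * ?c v * f y) x = k a * ?c v * D (?s u) f x"
      by (rule dunkl_mult[OF df[OF x]])
    also have "D (?s u) f x = D u f x - ?c u * D (coroot (fst a)) f x"
      by (rule dunkl_lin_refl[OF df[OF x]])
    finally show ?thesis by (simp add: algebra_simps)
  qed
  show ?thesis
    \<comment> \<open>The hypothesis at x is applied to f composed with s_a in the reflected
      directions; the other terms are unchanged when u and v are exchanged.\<close>
    unfolding *[of u v] *[of v u] comm[OF f', of "?s u"] by (simp add: algebra_simps)
qed

lemma dunkl_commute:
  assumes "x \<in> V" "twice_differentiable f"
  shows "D u (D v f) x = D v (D u f) x"
  using assms
\<comment> \<open>The directions and f must vary, since the transport step needs commutation at the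
  reflected point for reflected directions and composed functions.\<close>
proof (induction "card (S x)" arbitrary: x u v f rule: less_induct)
  case less
  show ?case
  proof (cases "S x = {}")
    case True
    then show ?thesis using dunkl_commute_fundamental_alcove less.prems by blast
  next
    case False
    then obtain a where a: "a \<in> B" "aff a x < 0" using exists_simple_negative by blast
    then have a\<Sigma>: "a \<in> \<Sigma>" using basis_in_affine_roots by blast
    define y where "y = aff_refl a x"
    have y: "y \<in> V" "x = aff_refl a y"
      using regular_aff_refl less.prems a\<Sigma> aff_refl_aff_refl[OF grad_nonzero]
      by (auto simp: y_def)
    have "card (S y) < card (S x)" unfolding y_def by (rule card_S_aff_refl[OF a])
    then show ?thesis
      using dunkl_commute_aff_refl[OF a(1) y(1) less.prems(2)] less.hyps y by metis
  qed
qed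

end

theorem theorem4p1:
  fixes R I0 :: "('a::euclidean_space \<Rightarrow>\<^sub>L real) set"
    and \<phi> :: "'a \<Rightarrow>\<^sub>L real"
    and k :: "('a \<Rightarrow>\<^sub>L real) \<times> real \<Rightarrow> real"
  assumes "root_system R" and "irreducible_roots R" and "reduced_roots R" and "crystallographic R"
    and "root_basis R I0" and "highest_root R I0 \<phi>"
    and "multiplicity_function R k"
  shows "(\<forall>v. \<forall>a\<in>affine_basis I0 \<phi>. \<forall>f\<in>C_infinity (V_reg R I0 \<phi>). \<forall>x\<in>V_reg R I0 \<phi>.
            act (aff_refl a) (dunkl R I0 \<phi> k v f) x =
              dunkl R I0 \<phi> k (lin_refl (fst a) v) (act (aff_refl a) f) x
              + complex_of_real (k a * blinfun_apply (fst a) v) * f x) \<and>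
         (\<forall>u v. \<forall>f\<in>C_infinity (V_reg R I0 \<phi>). \<forall>x\<in>V_reg R I0 \<phi>.
            dunkl R I0 \<phi> k u (dunkl R I0 \<phi> k v f) x =
              dunkl R I0 \<phi> k v (dunkl R I0 \<phi> k u f) x)"
proof -
  interpret affine_root_datum R I0 \<phi> k by unfold_locales fact+
  show ?thesis
  proof (intro conjI allI ballI)
    fix v a f x assume a: "a \<in> B" and f: "f \<in> C_infinity V" and x: "x \<in> V"
    have a\<Sigma>: "a \<in> \<Sigma>" using a basis_in_affine_roots by blast
    have "f differentiable (at (aff_refl a x))"
      using twice_differentiable_if_C_infinity[OF f] regular_aff_refl[OF x a\<Sigma>]
      by (simp add: twice_differentiable_def)
    moreover have "act (aff_refl a) g = (\<lambda>y. g (aff_refl a y))" for g :: "'a \<Rightarrow> complex"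
      using act_aff_refl[OF grad_nonzero[OF a\<Sigma>]] by blast
    ultimately show "act (aff_refl a) (D v f) x = D (lin_refl (fst a) v) (act (aff_refl a) f) x
        + complex_of_real (k a * blinfun_apply (fst a) v) * f x"
      using cross_relation[OF a x] by simp
  next
    fix u v f x assume "f \<in> C_infinity V" "x \<in> V"
    then show "D u (D v f) x = D v (D u f) x"
      by (intro dunkl_commute twice_differentiable_if_C_infinity)
  qed
qed

end
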